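(* Let $P\subseteq\mathbb{R}^d$ be a polytope with slack matrix $S$ and let $r$ be a positive integer. Consider the statements: (i) $P$ has a semidefinite extension $Q=\{(x,y)\in\mathbb{R}^{d+r(r+1)/2}\mid Ex+Fy=g,\ y\in\mathbb{S}^r_+\}$; (ii) the slack matrix $S$ has a rank-$r$ PSD factorization; (iii) there exists a one-way quantum communication protocol with $(r+1)$-dimensional messages (i.e., using $\lceil\log_2(r+1)\rceil$ qubits) that computes $S$ in expectation; (iii') there exists a one-way quantum communication protocol with $r$-dimensional messages that computes $S$ in expectation. Then (i) and (ii) are equivalent, each of them implies (iii), and (iii') implies each of (i) and (ii).
   Context: Slack matrix: if $P=\{x\in\mathbb{R}^d\mid Ax\leqslant b\}=\operatorname{conv}(V)$ with $A\in\mathbb{R}^{m\times d}$, $b\in\mathbb{R}^m$ and $V=\{v_1,\ldots,v_n\}$, the slack matrix of $P$ w.r.t. $Ax\leqslant b$ and $V$ is the nonnegative $m\times n$ matrix $S$ with $S_{ij}=b_i-A_iv_j$, where $A_i$ is the $i$th row of $A$. Here $S$ is the slack matrix w.r.t. any such description. All matrices are real; PSD means symmetric positive semidefinite. $\mathbb{S}^r_+$ is the cone of $r\times r$ PSD matrices, embedded in $\mathbb{R}^{r(r+1)/2}$ in such a way that the scalar product of two elements equals the Frobenius product $\operatorname{Tr}[X^{\intercal}Y]$ of the corresponding matrices. A set $Q=\{(x,y)\in\mathbb{R}^{d+r(r+1)/2}\mid Ex+Fy=g,\ y\in\mathbb{S}^r_+\}$ (for some real matrices $E,F$ and real vector $g$)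 is a semidefinite extension of $P$ if $P=\{x\in\mathbb{R}^d\mid\exists y: (x,y)\in Q\}$. A rank-$r$ PSD factorization of an $m\times n$ matrix $S$ is a collection of $r\times r$ PSD matrices $T_1,\ldots,T_m$, $U^1,\ldots,U^n$ with $\operatorname{Tr}[T_iU^j]=S_{ij}$ for all $i,j$. A $D$-dimensional quantum state is a $D\times D$ PSD matrix of trace $1$ (a $k$-qubit state is a state in dimension $2^k$). A POVM in dimension $D$ is a finite family $\{E_\theta\}_{\theta\in\Theta}$ of $D\times D$ PSD matrices, labeled by distinct real numbers $\theta$, summing to the identity; measuring $\rho$ yields outcome $\theta$ with probability $\operatorname{Tr}[E_\theta\rho]$. A one-way quantum protocol with $D$-dimensional messages consists of a $D$-dimensional state $\rho_i$ for each row index $i$ (sent by Alice) and a POVM $\{E^j_\theta\}$ with nonnegative labels $\theta$ for each column index $j$ (with which Bob measures, outputting the outcome). It computes $S$ in expectation if $\sum_\theta\theta\operatorname{Tr}[E^j_\theta\rho_i]=S_{ij}$ for all $i,j$. *)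

theory Defs
  imports "HOL-Analysis.Analysis" "HOL-Library.Uprod"
begin

section \<open>Positive semidefinite matrices\<close>

definition psd :: "real^'k^'k \<Rightarrow> bool" where
  "psd X \<longleftrightarrow> transpose X = X \<and> (\<forall>z. 0 \<le> z \<bullet> (X *v z))"

instance uprod :: (finite) finite
  by standard simp

text \<open>
  For \<open>r = CARD('r)\<close> the coordinates of \<open>real^'r uprod\<close> are the unordered pairs (with repetition)
  of matrix indices, so by \<open>card_UNIV_uprod\<close> this is the space of dimension \<open>r (r + 1) / 2\<close>.
  The map \<open>smat\<close> identifies it with the symmetric matrices; \<open>sqrt 2\<close> makes the identification
  an isometry for the Frobenius product.
\<close>
definition smat :: "real^('r::finite uprod) \<Rightarrow> real^'r^'r" where
  "smat y = (\<chi> i j. if i = j then y $ Upair i j else y $ Upair i j / sqrt 2)"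

definition psd_cone :: "(real^('r::finite uprod)) set" where
  "psd_cone = {y. psd (smat y)}"

lemma Upair_commute: "Upair a b = Upair b a"
  by simp

lemma transpose_smat: "transpose (smat y) = smat y"
proof -
  have "y $ Upair i j = y $ Upair j i" for i j
    by (subst Upair_commute) (rule refl)
  then show ?thesis
    unfolding smat_def transpose_def by (simp add: vec_eq_iff)
qed

lemma range_smat: "range smat = {X :: real^'r^'r. transpose X = X}"
proof (intro equalityI subsetI)
  fix X :: "real^'r^'r" assume "X \<in> {X. transpose X = X}"
  then have sym: "X $ i $ j = X $ j $ i" for i j
    by (auto simp: transpose_def vec_eq_iff)
  define f where "f = (\<lambda>i j. if i = j then X $ i $ j else sqrt 2 * X $ i $ j)"
  have "\<forall>u. \<exists>c. \<forall>i j. u = Upair i j \<longrightarrow> c = f i j"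
  proof
    fix u :: "'r uprod"
    obtain a b where "u = Upair a b" by (cases u)
    then show "\<exists>c. \<forall>i j. u = Upair i j \<longrightarrow> c = f i j"
      by (intro exI[of _ "f a b"]) (auto simp: f_def sym)
  qed
  from choice[OF this] obtain c where c: "c (Upair i j) = f i j" for i j by blast
  have "smat (\<chi> u. c u) = X"
    by (simp add: smat_def vec_eq_iff c f_def)
  then show "X \<in> range smat" by (metis rangeI)
qed (auto simp: transpose_smat)

lemma inner_smat: "trace (transpose (smat x) ** smat y) = x \<bullet> y"
proof -
  let ?f = "\<lambda>(i, j). smat x $ i $ j * smat y $ i $ j"
  have fib: "sum ?f {p. case_prod Upair p = u} = x $ u * y $ u" for u
  proof (cases u)
    case (Upair a b)
    have eq: "{p. case_prod Upair p = u} = {(a, b), (b, a)}" by (auto simp: Upair)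
    show ?thesis
      unfolding eq
      by (cases "a = b") (simp_all add: smat_def Upair Upair_commute[of b a] field_simps)
  qed
  have "trace (transpose (smat x) ** smat y) = (\<Sum>j\<in>UNIV. \<Sum>i\<in>UNIV. smat x $ i $ j * smat y $ i $ j)"
    by (simp add: trace_def matrix_matrix_mult_def transpose_def)
  also have "\<dots> = sum ?f UNIV"
    by (subst sum.swap) (simp add: sum.cartesian_product)
  also have "\<dots> = (\<Sum>u\<in>UNIV. sum ?f {p \<in> UNIV. case_prod Upair p = u})"
    by (rule sum.group[symmetric]) auto
  also have "\<dots> = x \<bullet> y" by (simp add: fib inner_vec_def)
  finally show ?thesis .
qed

section \<open>Semidefinite extensions and PSD factorizations\<close>

text \<open>
  \<open>E k\<close>, \<open>F k\<close> and \<open>g k\<close> for \<open>k < p\<close> are the rows of the system \<open>E x + F y = g\<close>; the number of rows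
  is existentially quantified and hence cannot be a type. Likewise, an \<open>m \<times> n\<close> matrix \<open>S\<close> is given
  by its entries \<open>S i j\<close> with \<open>i < m\<close> and \<open>j < n\<close>.
\<close>
definition semidefinite_extension ::
    "((real^'d) \<times> (real^('r::finite uprod))) set \<Rightarrow> (real^'d) set \<Rightarrow> bool" where
  "semidefinite_extension Q P \<longleftrightarrow>
     (\<exists>p E F g. Q = {(x, y). (\<forall>k<(p::nat). E k \<bullet> x + F k \<bullet> y = g k) \<and> y \<in> psd_cone}) \<and>
     P = {x. \<exists>y. (x, y) \<in> Q}"

definition has_semidefinite_extension :: "'r::finite itself \<Rightarrow> (real^'d) set \<Rightarrow> bool" where
  "has_semidefinite_extension _ P \<longleftrightarrow>
     (\<exists>Q :: ((real^'d) \<times> (real^('r uprod))) set. semidefinite_extension Q P)"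

definition has_psd_factorization ::
    "'r::finite itself \<Rightarrow> nat \<Rightarrow> nat \<Rightarrow> (nat \<Rightarrow> nat \<Rightarrow> real) \<Rightarrow> bool" where
  "has_psd_factorization _ m n S \<longleftrightarrow>
     (\<exists>(T :: nat \<Rightarrow> real^'r^'r) (U :: nat \<Rightarrow> real^'r^'r).
        (\<forall>i<m. psd (T i)) \<and> (\<forall>j<n. psd (U j)) \<and>
        (\<forall>i<m. \<forall>j<n. trace (T i ** U j) = S i j))"

section \<open>One-way quantum protocols\<close>

definition quantum_state :: "real^'D^'D \<Rightarrow> bool" where
  "quantum_state \<rho> \<longleftrightarrow> psd \<rho> \<and> trace \<rho> = 1"

definition povm :: "real set \<Rightarrow> (real \<Rightarrow> real^'D^'D) \<Rightarrow> bool" where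
  "povm \<Theta> E \<longleftrightarrow> finite \<Theta> \<and> (\<forall>\<theta>\<in>\<Theta>. psd (E \<theta>)) \<and> (\<Sum>\<theta>\<in>\<Theta>. E \<theta>) = mat 1"

definition one_way_protocol ::
    "nat \<Rightarrow> nat \<Rightarrow> (nat \<Rightarrow> real^'D^'D) \<Rightarrow> (nat \<Rightarrow> real set) \<Rightarrow> (nat \<Rightarrow> real \<Rightarrow> real^'D^'D) \<Rightarrow> bool" where
  "one_way_protocol m n \<rho> \<Theta> E \<longleftrightarrow>
     (\<forall>i<m. quantum_state (\<rho> i)) \<and> (\<forall>j<n. povm (\<Theta> j) (E j) \<and> (\<forall>\<theta>\<in>\<Theta> j. 0 \<le> \<theta>))"

definition computes_in_expectation ::
    "nat \<Rightarrow> nat \<Rightarrow> (nat \<Rightarrow> nat \<Rightarrow> real) \<Rightarrow>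
     (nat \<Rightarrow> real^'D^'D) \<Rightarrow> (nat \<Rightarrow> real set) \<Rightarrow> (nat \<Rightarrow> real \<Rightarrow> real^'D^'D) \<Rightarrow> bool" where
  "computes_in_expectation m n S \<rho> \<Theta> E \<longleftrightarrow>
     (\<forall>i<m. \<forall>j<n. (\<Sum>\<theta>\<in>\<Theta> j. \<theta> * trace (E j \<theta> ** \<rho> i)) = S i j)"

definition has_quantum_protocol ::
    "'D::finite itself \<Rightarrow> nat \<Rightarrow> nat \<Rightarrow> (nat \<Rightarrow> nat \<Rightarrow> real) \<Rightarrow> bool" where
  "has_quantum_protocol _ m n S \<longleftrightarrow>
     (\<exists>(\<rho> :: nat \<Rightarrow> real^'D^'D) \<Theta> E.
        one_way_protocol m n \<rho> \<Theta> E \<and> computes_in_expectation m n S \<rho> \<Theta> E)"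

end

theory Submission
  imports Defs
begin

text \<open>
  A factorization \<open>T\<close>, \<open>U\<close> gives the extension \<open>A x + Tr (T y) = b\<close>. Conversely, conic duality applied
  to the \<open>i\<close>-th inequality gives \<open>b i - A i x = Tr (T i y) + c\<close> on the extension. There may be no
  positive definite feasible point, so duality is applied on the smallest face of the cone that
  contains all feasible \<open>y\<close>, and the multiplier is then extended from that face to the whole cone.
  The constant \<open>c\<close> is absorbed without increasing the rank, because on a polytope that is not a
  point every positive constant is itself of the form \<open>Tr (C y)\<close>.
\<close>

section \<open>Positive semidefinite matrices\<close>

definition outer :: "real^'k \<Rightarrow> real^'k^'k" where
  "outer w = (\<chi> i j. w $ i * w $ j)"

lemma transpose_add: "transpose (X + Y) = transpose X + transpose (Y :: 'a::plus^'k^'l)"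
  by (simp add: transpose_def vec_eq_iff)

lemma transpose_diff: "transpose (X - Y) = transpose X - transpose (Y :: 'a::minus^'k^'l)"
  by (simp add: transpose_def vec_eq_iff)

lemma trace_scaleR: "trace (c *\<^sub>R X) = c * trace (X :: real^'k^'k)"
  by (simp add: trace_def sum_distrib_left)

lemma matrix_add_rdistrib: "(X + Y) ** Z = X ** Z + Y ** (Z :: real^'k^'l)"
  by (simp add: matrix_matrix_mult_def vec_eq_iff sum.distrib distrib_right)

lemma matrix_mult_scaleR_left: "(c *\<^sub>R X) ** Y = c *\<^sub>R (X ** Y)" for X :: "real^'k^'l"
  by (simp add: matrix_matrix_mult_def vec_eq_iff sum_distrib_left mult.assoc)

lemma matrix_mult_scaleR_right: "X ** (c *\<^sub>R Y) = c *\<^sub>R (X ** Y)" for X :: "real^'k^'l"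
  by (simp add: matrix_matrix_mult_def vec_eq_iff sum_distrib_left mult.left_commute)

lemma matrix_scaleR_vector: "(c *\<^sub>R X) *v z = c *\<^sub>R (X *v z)" for X :: "real^'k^'l"
  by (simp add: scaleR_matrix_vector_assoc)

lemma inner_transpose_mult: "z \<bullet> (transpose X *v w) = (X *v z) \<bullet> w" for X :: "real^'k^'l"
  by (metis dot_lmul_matrix inner_commute transpose_matrix_vector)

lemma outer_mult: "outer w *v z = (w \<bullet> z) *\<^sub>R w"
  by (simp add: outer_def matrix_vector_mult_def inner_vec_def vec_eq_iff sum_distrib_left sum_distrib_right mult_ac)

lemma transpose_outer [simp]: "transpose (outer w) = outer w"
  by (simp add: outer_def transpose_def vec_eq_iff mult.commute)

lemma trace_outer: "trace (outer w) = w \<bullet> w"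
  by (simp add: trace_def outer_def inner_vec_def)

lemma trace_mult_outer: "trace (X ** outer w) = w \<bullet> (X *v w)"
  by (simp add: trace_def matrix_matrix_mult_def outer_def inner_vec_def matrix_vector_mult_def
      sum_distrib_left mult_ac)

section \<open>Closure properties of the PSD cone\<close>

lemma psd_transpose: "psd X \<Longrightarrow> transpose X = X"
  by (simp add: psd_def)

lemma psd_inner_nonneg: "psd X \<Longrightarrow> 0 \<le> z \<bullet> (X *v z)"
  by (simp add: psd_def)

lemma psd_inner_commute: "psd X \<Longrightarrow> z \<bullet> (X *v w) = w \<bullet> (X *v z)"
  by (metis inner_commute inner_transpose_mult psd_transpose)

lemma psd_zero: "psd 0"
  by (simp add: psd_def transpose_def vec_eq_iff)

lemma psd_add: "psd X \<Longrightarrow> psd Y \<Longrightarrow> psd (X + Y)"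
  by (simp add: psd_def transpose_add matrix_vector_mult_add_rdistrib inner_add_right)

lemma psd_scaleR: "0 \<le> c \<Longrightarrow> psd X \<Longrightarrow> psd (c *\<^sub>R X)"
  by (simp add: psd_def transpose_scalar matrix_scaleR_vector)

lemma psd_sum: "(\<And>x. x \<in> I \<Longrightarrow> psd (f x)) \<Longrightarrow> psd (\<Sum>x\<in>I. f x)"
  by (induction I rule: infinite_finite_induct) (auto simp: psd_zero intro: psd_add)

lemma psd_outer: "psd (outer w)"
  by (simp add: psd_def outer_mult inner_commute)

lemma psd_mat1: "psd (mat 1)"
  by (simp add: psd_def transpose_mat)

lemma psd_congruence: "psd X \<Longrightarrow> psd (transpose B ** X ** B)"
  unfolding psd_def
  by (simp add: matrix_transpose_mul matrix_mul_assoc matrix_vector_mul_assoc[symmetric]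
      inner_transpose_mult del: transpose_matrix_vector)

lemma psd_trace_nonneg: "psd X \<Longrightarrow> 0 \<le> trace X"
  unfolding trace_def
proof (rule sum_nonneg)
  fix k assume "psd X"
  then have "0 \<le> axis k 1 \<bullet> (X *v axis k 1)" by (rule psd_inner_nonneg)
  then show "0 \<le> X $ k $ k"
    by (simp add: inner_axis' matrix_vector_mult_basis column_def)
qed

text \<open>The form of \<open>X\<close> is nonnegative at every \<open>z - s *\<^sub>R w\<close>,
  hence so is a quadratic polynomial in \<open>s\<close>; its minimizer \<open>b / c\<close> gives
  the bound.\<close>

lemma psd_Cauchy_Schwarz:
  assumes X: "psd X"
  shows "(z \<bullet> (X *v w))\<^sup>2 \<le> (z \<bullet> (X *v z)) * (w \<bullet> (X *v w))"
proof -
  define a b c where "a = z \<bullet> (X *v z)" and "b = z \<bullet> (X *v w)" and "c = w \<bullet> (X *v w)"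
  have quad: "0 \<le> a - 2 * s * b + s\<^sup>2 * c" for s
  proof -
    have "0 \<le> (z - s *\<^sub>R w) \<bullet> (X *v (z - s *\<^sub>R w))"
      by (rule psd_inner_nonneg[OF X])
    also have "\<dots> = a - 2 * s * b + s\<^sup>2 * c"
      unfolding a_def b_def c_def
      by (simp add: matrix_vector_mult_diff_distrib matrix_vector_mult_scaleR inner_diff_left
          inner_diff_right psd_inner_commute[OF X, of w z] power2_eq_square algebra_simps)
    finally show ?thesis .
  qed
  have "0 \<le> c" unfolding c_def by (rule psd_inner_nonneg[OF X])
  show ?thesis
  proof (cases "c = 0")
    case True
    have "b = 0"
    proof (rule ccontr)
      assume "b \<noteq> 0"
      \<comment> \<open>With \<open>c = 0\<close> the polynomial is affine in \<open>s\<close>; this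
        choice gives it the value \<open>-1\<close>.\<close>
      then show False using quad[of "(a + 1) / (2 * b)"] True by simp
    qed
    then show ?thesis using True by (simp add: a_def b_def c_def)
  next
    case False
    then have "0 \<le> (a - 2 * (b / c) * b + (b / c)\<^sup>2 * c) * c"
      using quad[of "b / c"] \<open>0 \<le> c\<close> by simp
    also have "\<dots> = a * c - b\<^sup>2"
      using False by (simp add: field_simps power2_eq_square)
    finally show ?thesis by (simp add: a_def b_def c_def)
  qed
qed

text \<open>Cauchy-Schwarz with test vector \<open>X *v z\<close> bounds the fourth power of the
  norm of \<open>X *v z\<close> by a multiple of the form at \<open>z\<close>.\<close>

lemma psd_mult_eq_0:
  assumes X: "psd X" and "z \<bullet> (X *v z) = 0"
  shows "X *v z = 0"
proof -
  have "((X *v z) \<bullet> (X *v z))\<^sup>2 \<le> 0"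
    using psd_Cauchy_Schwarz[OF X, of "X *v z" z] assms(2) by simp
  then show ?thesis by simp
qed

text \<open>Cauchy-Schwarz as a matrix inequality. It drives the elimination step of the Cholesky
  argument, the trace bound on the spectrum, and the membership of \<open>outer (X *v u)\<close> in
  the face of \<open>X\<close>.\<close>

lemma psd_diff_outer:
  assumes X: "psd X"
  shows "psd ((u \<bullet> (X *v u)) *\<^sub>R X - outer (X *v u))"
  unfolding psd_def
proof (intro conjI allI)
  show "transpose ((u \<bullet> (X *v u)) *\<^sub>R X - outer (X *v u)) = (u \<bullet> (X *v u)) *\<^sub>R X - outer (X *v u)"
    by (simp add: transpose_diff transpose_scalar psd_transpose[OF X])
  show "0 \<le> z \<bullet> (((u \<bullet> (X *v u)) *\<^sub>R X - outer (X *v u)) *v z)" for z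
    using psd_Cauchy_Schwarz[OF X, of z u]
    by (simp add: matrix_vector_mult_diff_rdistrib outer_mult matrix_scaleR_vector inner_diff_right
        power2_eq_square inner_commute mult.commute)
qed

text \<open>
  Induction on the number of nonzero diagonal entries of \<open>X\<close>: as in a Cholesky factorization,
  subtracting a rank-one matrix clears a row and the corresponding column.
\<close>
lemma psd_trace_mult_nonneg:
  assumes T: "psd T" and "psd X"
  shows "0 \<le> trace (T ** X)"
  using assms(2)
proof (induction "card {k. X $ k $ k \<noteq> 0}" arbitrary: X rule: less_induct)
  case less
  note X = less.prems
  have ax: "axis k 1 \<bullet> (Z *v axis k 1) = Z $ k $ k" for Z :: "real^'a^'a" and k
    by (simp add: inner_axis' matrix_vector_mult_basis column_def)
  have col: "X *v axis k 1 = 0" if "X $ k $ k = 0" for k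
    using psd_mult_eq_0[OF X, of "axis k 1"] that by (simp add: ax)
  show ?case
  proof (cases "\<exists>k. X $ k $ k \<noteq> 0")
    case False
    have "column k X = 0" for k
      using col[of k] False by (simp add: matrix_vector_mult_basis)
    then have "X = 0" by (simp add: column_def vec_eq_iff)
    then show ?thesis by (simp add: trace_def matrix_matrix_mult_def)
  next
    case True
    then obtain k where k: "X $ k $ k \<noteq> 0" by blast
    define c where "c = X $ k $ k"
    have c: "0 < c"
      using psd_inner_nonneg[OF X, of "axis k 1"] k by (simp add: ax c_def)
    define w where "w = X *v axis k 1"
    define X' where "X' = X - (1 / c) *\<^sub>R outer w"
    have X': "psd X'"
    proof -
      have "psd ((1 / c) *\<^sub>R (c *\<^sub>R X - outer w))"
        using psd_diff_outer[OF X, of "axis k 1"] c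
        by (intro psd_scaleR) (simp_all add: ax c_def w_def)
      then show ?thesis using c by (simp add: X'_def scaleR_diff_right)
    qed
    have wl: "w $ l = X $ l $ k" for l
      by (simp add: w_def matrix_vector_mult_basis column_def)
    have "X' $ k $ k = 0"
      using c by (simp add: X'_def outer_def wl c_def)
    \<comment> \<open>The subtraction must not refill a zero diagonal entry: row and column
      \<open>l\<close> of \<open>X\<close> vanish already, so \<open>w\<close> vanishes at
      \<open>l\<close>.\<close>
    moreover have "X' $ l $ l = 0" if "X $ l $ l = 0" for l
    proof -
      have "w $ l = X $ k $ l"
        using arg_cong[OF psd_transpose[OF X], of "\<lambda>Z. Z $ k $ l"] by (simp add: wl transpose_def)
      also have "\<dots> = 0"
        using arg_cong[OF col[OF that], of "\<lambda>z. z $ k"]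
        by (simp add: matrix_vector_mult_basis column_def)
      finally show ?thesis using that by (simp add: X'_def outer_def)
    qed
    ultimately have "{l. X' $ l $ l \<noteq> 0} \<subset> {l. X $ l $ l \<noteq> 0}"
      using k by blast
    then have "card {l. X' $ l $ l \<noteq> 0} < card {l. X $ l $ l \<noteq> 0}"
      by (intro psubset_card_mono) auto
    then have "0 \<le> trace (T ** X')" using X' by (rule less.hyps)
    moreover have "trace (T ** X) = trace (T ** X') + (1 / c) * (w \<bullet> (T *v w))"
    proof -
      have "X = X' + (1 / c) *\<^sub>R outer w" by (simp add: X'_def)
      then have "trace (T ** X) = trace (T ** (X' + (1 / c) *\<^sub>R outer w))" by simp
      also have "\<dots> = trace (T ** X') + (1 / c) * (w \<bullet> (T *v w))"
        by (simp add: matrix_add_ldistrib trace_add matrix_mult_scaleR_right trace_scaleR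
            trace_mult_outer)
      finally show ?thesis .
    qed
    ultimately show ?thesis
      using c psd_inner_nonneg[OF T, of w] by simp
  qed
qed

text \<open>\<open>P\<close> is the sum of \<open>outer b\<close> over an orthonormal basis.
  Residuals are orthogonal to the basis, hence to its span.\<close>

lemma orthogonal_projection_matrix:
  fixes V :: "(real^'k) set"
  assumes V: "subspace V"
  obtains P :: "real^'k^'k" where "transpose P = P" "\<And>z. P *v z \<in> V"
    "\<And>z w. w \<in> V \<Longrightarrow> w \<bullet> (z - P *v z) = 0"
proof -
  obtain B where B: "B \<subseteq> V" "pairwise orthogonal B" "\<And>x. x \<in> B \<Longrightarrow> norm x = 1"
      "independent B" "span B = V"
    using orthonormal_basis_subspace[OF V] by metis
  define P where "P = (\<Sum>b\<in>B. outer b)"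
  have "finite B" using B(4) by (rule independent_imp_finite)
  have Pz: "P *v z = (\<Sum>b\<in>B. (b \<bullet> z) *\<^sub>R b)" for z
    unfolding P_def using \<open>finite B\<close>
    by (induction B) (simp_all add: matrix_vector_mult_add_rdistrib outer_mult)
  show thesis
  proof
    show "transpose P = P"
      unfolding P_def by (intro psd_transpose psd_sum psd_outer)
    show "P *v z \<in> V" for z
      unfolding Pz using B(1) V by (intro subspace_sum subspace_scale) auto
    fix z w assume w: "w \<in> V"
    have "b \<bullet> (z - P *v z) = 0" if b: "b \<in> B" for b
    proof -
      have "b \<bullet> (P *v z) = (\<Sum>c\<in>B. (c \<bullet> z) * (b \<bullet> c))"
        by (simp add: Pz inner_sum_right)
      also have "\<dots> = (\<Sum>c\<in>B. if c = b then b \<bullet> z else 0)"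
      proof (rule sum.cong)
        fix c assume "c \<in> B"
        then show "(c \<bullet> z) * (b \<bullet> c) = (if c = b then b \<bullet> z else 0)"
          using B(2) B(3)[OF b] b by (auto simp: pairwise_def orthogonal_def dot_square_norm)
      qed simp
      also have "\<dots> = b \<bullet> z" using \<open>finite B\<close> b by simp
      finally show ?thesis by (simp add: inner_diff_right)
    qed
    then have "orthogonal (z - P *v z) w"
      using w B(5) by (intro orthogonal_to_span[of w B]) (auto simp: orthogonal_def inner_commute)
    then show "w \<bullet> (z - P *v z) = 0" by (simp add: orthogonal_def inner_commute)
  qed
qed


text \<open>Bounds the spectrum without eigenvalues: the form at \<open>z\<close> is the trace of
  \<open>X\<close> against \<open>|z|^2 I - outer z\<close>, which is PSD by Cauchy-Schwarz for the
  identity.\<close>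

lemma psd_le_trace:
  fixes X :: "real^'k^'k"
  assumes "psd X"
  shows "psd (trace X *\<^sub>R mat 1 - X)"
  unfolding psd_def
proof (intro conjI allI)
  show "transpose (trace X *\<^sub>R mat 1 - X) = trace X *\<^sub>R mat 1 - X"
    by (simp add: transpose_diff transpose_scalar transpose_mat psd_transpose[OF assms])
  fix z :: "real^'k"
  have "psd ((z \<bullet> z) *\<^sub>R mat 1 + (-1) *\<^sub>R outer z)"
    using psd_diff_outer[OF psd_mat1, of z] by simp
  then have "0 \<le> trace (X ** ((z \<bullet> z) *\<^sub>R mat 1 + (-1) *\<^sub>R outer z))"
    by (rule psd_trace_mult_nonneg[OF assms])
  also have "\<dots> = z \<bullet> ((trace X *\<^sub>R mat 1 - X) *v z)"
    by (simp only: matrix_add_ldistrib trace_add matrix_mult_scaleR_right trace_scaleR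
        trace_mult_outer)
      (simp add: matrix_vector_mult_diff_rdistrib matrix_scaleR_vector inner_diff_right mult.commute)
  finally show "0 \<le> z \<bullet> ((trace X *\<^sub>R mat 1 - X) *v z)" .
qed

text \<open>
  The matrices \<open>Z\<close> below make up the smallest face of the cone that contains \<open>X\<close>. Compressing \<open>T\<close>
  to the range of \<open>X\<close> preserves the trace form on that face, and every vector \<open>w\<close> in the range
  gives a member \<open>outer w\<close> of the face.
\<close>
lemma psd_extend_from_face:
  assumes X: "psd X" and T: "transpose T = T"
    and face: "\<And>Z N. psd Z \<Longrightarrow> 0 \<le> N \<Longrightarrow> psd (N *\<^sub>R X - Z) \<Longrightarrow> 0 \<le> trace (T ** Z)"
  obtains T' where "psd T'"
    "\<And>Z N. psd Z \<Longrightarrow> 0 \<le> N \<Longrightarrow> psd (N *\<^sub>R X - Z) \<Longrightarrow> trace (T' ** Z) = trace (T ** Z)"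
proof -
  have "subspace (range ((*v) X))"
    by (intro linear_subspace_image) auto
  then obtain P where P: "transpose P = P" "\<And>z. P *v z \<in> range ((*v) X)"
      "\<And>z w. w \<in> range ((*v) X) \<Longrightarrow> w \<bullet> (z - P *v z) = 0"
    using orthogonal_projection_matrix by metis
  show thesis
  proof
    show "psd (P ** T ** P)"
      unfolding psd_def
    proof (intro conjI allI)
      show "transpose (P ** T ** P) = P ** T ** P"
        by (simp add: matrix_transpose_mul P(1) T matrix_mul_assoc)
      fix z
      obtain u where u: "P *v z = X *v u" using P(2)[of z] by auto
      \<comment> \<open>With \<open>P *v z = X *v u\<close>, the form of \<open>P ** T ** P\<close>
        at \<open>z\<close> is the trace of \<open>T\<close> against a member of the face;
        \<open>psd_diff_outer\<close> supplies the multiple \<open>N\<close>.\<close>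
      have "0 \<le> trace (T ** outer (X *v u))"
        by (rule face[of _ "u \<bullet> (X *v u)"])
          (auto intro: psd_outer psd_inner_nonneg psd_diff_outer X)
      also have "\<dots> = z \<bullet> ((P ** T ** P) *v z)"
        using inner_transpose_mult[of z P "T *v (P *v z)"]
        by (simp add: trace_mult_outer u[symmetric] P(1) matrix_vector_mul_assoc[symmetric]
            del: transpose_matrix_vector)
      finally show "0 \<le> z \<bullet> ((P ** T ** P) *v z)" .
    qed
    fix Z N assume Z: "psd Z" and N: "0 \<le> N" "psd (N *\<^sub>R X - Z)"
    \<comment> \<open>Vectors orthogonal to the range of \<open>X\<close> are killed by
      \<open>X\<close>, and then by \<open>Z\<close>, whose form lies between zero and that of
      \<open>N *\<^sub>R X\<close>.\<close>
    have "Z *v (z - P *v z) = 0" for z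
    proof -
      define d where "d = z - P *v z"
      have "w \<bullet> (X *v d) = 0" for w
        using P(3)[of "X *v w" z] psd_inner_commute[OF X, of w d]
        by (simp add: d_def inner_commute)
      then have "X *v d = 0" by (metis inner_eq_zero_iff)
      then have "d \<bullet> (Z *v d) = 0"
        using psd_inner_nonneg[OF N(2), of d] psd_inner_nonneg[OF Z, of d]
        by (simp add: matrix_vector_mult_diff_rdistrib matrix_scaleR_vector inner_diff_right)
      then show ?thesis unfolding d_def by (rule psd_mult_eq_0[OF Z])
    qed
    then have ZP: "Z ** P = Z"
      by (simp add: matrix_eq matrix_vector_mult_diff_distrib matrix_vector_mul_assoc[symmetric])
    then have PZ: "P ** Z = Z"
      by (metis P(1) Z matrix_transpose_mul psd_transpose)
    have "trace (P ** T ** P ** Z) = trace (P ** (T ** Z))"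
      by (simp add: matrix_mul_assoc[symmetric] PZ)
    also have "\<dots> = trace (T ** (Z ** P))"
      by (subst trace_mul_sym) (simp add: matrix_mul_assoc)
    finally show "trace (P ** T ** P ** Z) = trace (T ** Z)"
      by (simp add: ZP)
  qed
qed

section \<open>Conic duality\<close>

text \<open>Along the line through two points with different values, a linear functional is
  unbounded below.\<close>

lemma affine_bounded_below_const:
  fixes f :: "'a::real_vector \<Rightarrow> real"
  assumes H: "affine H" and f: "linear f" and bdd: "\<And>p. p \<in> H \<Longrightarrow> B \<le> f p"
    and "p \<in> H" "q \<in> H"
  shows "f p = f q"
proof (rule ccontr)
  assume neq: "f p \<noteq> f q"
  \<comment> \<open>Chosen so that the functional takes the value \<open>B - 1\<close>.\<close>
  define s where "s = (f p - B + 1) / (f p - f q)"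
  have "(1 - s) *\<^sub>R p + s *\<^sub>R q \<in> H"
    using H \<open>p \<in> H\<close> \<open>q \<in> H\<close> by (auto simp: affine_alt)
  then have "B \<le> (1 - s) * f p + s * f q"
    using bdd f by (force simp: linear_add linear_scale)
  also have "\<dots> = f p - s * (f p - f q)" by (simp add: algebra_simps)
  also have "\<dots> = B - 1" using neq by (simp add: s_def)
  finally show False by simp
qed

text \<open>
  Facial reduction: \<open>y0\<close> lies in the relative interior of the feasible part of \<open>K\<close>, so that the
  smallest face of \<open>K\<close> containing \<open>y0\<close> contains every feasible point. On this face \<open>y0\<close> is a
  Slater point, hence strong duality holds with attainment.
\<close>
lemma cone_duality:
  fixes H :: "('a::euclidean_space \<times> 'b::euclidean_space) set" and \<alpha> :: 'a and \<beta> :: real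
  assumes H: "affine H" and K: "convex K" "cone K" and "(x1, y1) \<in> H" "y1 \<in> K"
    and valid: "\<And>x y. (x, y) \<in> H \<Longrightarrow> y \<in> K \<Longrightarrow> \<alpha> \<bullet> x \<le> \<beta>"
  obtains y0 c t where "y0 \<in> K" "0 \<le> c"
    "\<And>k N. k \<in> K \<Longrightarrow> 0 \<le> N \<Longrightarrow> N *\<^sub>R y0 - k \<in> K \<Longrightarrow> 0 \<le> t \<bullet> k"
    "\<And>x y. (x, y) \<in> H \<Longrightarrow> y \<in> K \<Longrightarrow> \<exists>N\<ge>0. N *\<^sub>R y0 - y \<in> K"
    "\<And>x y. (x, y) \<in> H \<Longrightarrow> y \<in> K \<Longrightarrow> \<beta> - \<alpha> \<bullet> x = t \<bullet> y + c"
proof -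
  have Kadd: "x + y \<in> K" if "x \<in> K" "y \<in> K" for x y
    using K that convex_cone by blast
  have Kscale: "c *\<^sub>R x \<in> K" if "x \<in> K" "0 \<le> c" for x c
    using K that by (simp add: mem_cone)
  define W where "W = snd ` H \<inter> K"
  have "convex W"
    unfolding W_def
    by (intro convex_Int convex_linear_image affine_imp_convex linear_snd H K(1))
  moreover have "W \<noteq> {}" using assms(4,5) by (force simp: W_def)
  ultimately obtain y0 where y0: "y0 \<in> rel_interior W"
    using rel_interior_eq_empty by blast
  then have "y0 \<in> W" using rel_interior_subset by blast
  then obtain x0 where x0: "(x0, y0) \<in> H" and y0K: "y0 \<in> K" by (auto simp: W_def)
  \<comment> \<open>\<open>K'\<close> is the smallest face of \<open>K\<close> containing
    \<open>y0\<close>: the points dominated by a multiple of \<open>y0\<close> in the order of the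
    cone.\<close>
  define K' where "K' = {k \<in> K. \<exists>N\<ge>0. N *\<^sub>R y0 - k \<in> K}"
  have K'I: "k \<in> K'" if "k \<in> K" "0 \<le> N" "N *\<^sub>R y0 - k \<in> K" for k N
    using that by (auto simp: K'_def)
  have "0 \<in> K" using Kscale[OF y0K, of 0] by simp
  then have y0K': "y0 \<in> K'" and zeroK': "0 \<in> K'"
    using K'I[OF y0K, of 1] K'I[of 0 0] by auto
  have K'add: "k + l \<in> K'" if kl: "k \<in> K'" "l \<in> K'" for k l
  proof -
    obtain M N where "k \<in> K" "l \<in> K" "0 \<le> M" "0 \<le> N" "M *\<^sub>R y0 - k \<in> K" "N *\<^sub>R y0 - l \<in> K"
      using kl by (auto simp: K'_def)
    then show ?thesis
      using Kadd[of "M *\<^sub>R y0 - k" "N *\<^sub>R y0 - l"]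
      by (intro K'I[of _ "M + N"]) (auto simp: Kadd algebra_simps)
  qed
  have K'scale: "c *\<^sub>R k \<in> K'" if kc: "k \<in> K'" "0 \<le> c" for k c
  proof -
    obtain N where "k \<in> K" "0 \<le> N" "N *\<^sub>R y0 - k \<in> K"
      using kc by (auto simp: K'_def)
    then show ?thesis
      using Kscale[of "N *\<^sub>R y0 - k" c] kc
      by (intro K'I[of _ "c * N"]) (auto simp: Kscale algebra_simps)
  qed
  \<comment> \<open>The segment from \<open>w\<close> to \<open>y0\<close> extends beyond
    \<open>y0\<close> inside \<open>W\<close>; its far end, rescaled, is a multiple of
    \<open>y0\<close> minus \<open>w\<close>.\<close>
  have WK': "w \<in> K'" if w: "w \<in> W" for w
  proof -
    obtain e where e: "1 < e" "(1 - e) *\<^sub>R w + e *\<^sub>R y0 \<in> W"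
      using y0 w convex_rel_interior_iff[OF \<open>convex W\<close> \<open>W \<noteq> {}\<close>] by blast
    then have "(1 / (e - 1)) *\<^sub>R ((1 - e) *\<^sub>R w + e *\<^sub>R y0) \<in> K"
      by (intro Kscale) (auto simp: W_def)
    also have "(1 / (e - 1)) *\<^sub>R ((1 - e) *\<^sub>R w + e *\<^sub>R y0) = (e / (e - 1)) *\<^sub>R y0 - w"
    proof -
      have "(1 - e) / (e - 1) = -1" using e by (simp add: field_simps)
      then show ?thesis by (simp add: scaleR_add_right)
    qed
    finally show ?thesis
      using w e by (intro K'I[of _ "e / (e - 1)"]) (auto simp: W_def)
  qed
  \<comment> \<open>Only the span of the face is imposed here, so the set stays affine; the cone
    itself enters through \<open>k\<close> in \<open>S\<close>.\<close>
  define H' where "H' = H \<inter> {p. snd p \<in> span K'}"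
  have aff: "affine H'"
    unfolding H'_def affine_def
    using H by (auto simp: affine_def intro!: span_add span_scale)
  have H'I: "(x, y) \<in> H'" if "(x, y) \<in> H" "y \<in> K'" for x y
    using that by (auto simp: H'_def span_base)
  \<comment> \<open>Cone residuals paired with strictly relaxed objective gaps. Zero is not
    attained: \<open>y = k\<close> makes \<open>(x, y)\<close> feasible, and then the second
    component is positive.\<close>
  define S where "S = {(y - k, \<beta> - \<alpha> \<bullet> x + s) | x y k s. (x, y) \<in> H' \<and> k \<in> K' \<and> (0::real) < s}"
  have SI: "(y - k, \<beta> - \<alpha> \<bullet> x + s) \<in> S" if "(x, y) \<in> H'" "k \<in> K'" "0 < s" for x y k s
    using that unfolding S_def by blast
  have "convex S"
  proof (rule convexI)
    fix p q u v assume "p \<in> S" "q \<in> S" and uv: "0 \<le> u" "0 \<le> v" "u + v = (1::real)"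
    then obtain x y k s x' y' k' s'
      where p: "p = (y - k, \<beta> - \<alpha> \<bullet> x + s)" "(x, y) \<in> H'" "k \<in> K'" "0 < s"
        and q: "q = (y' - k', \<beta> - \<alpha> \<bullet> x' + s')" "(x', y') \<in> H'" "k' \<in> K'" "0 < s'"
      unfolding S_def by blast
    have "(u *\<^sub>R x + v *\<^sub>R x', u *\<^sub>R y + v *\<^sub>R y') \<in> H'"
      using mem_affine[OF aff p(2) q(2), of u v] uv by simp
    moreover have "u *\<^sub>R k + v *\<^sub>R k' \<in> K'"
      using p q uv by (intro K'add K'scale)
    moreover have "0 < u * s + v * s'"
    proof (cases "u = 0")
      case False
      then show ?thesis using p q uv by (intro add_pos_nonneg) auto
    qed (use q uv in simp)
    moreover have "u *\<^sub>R p + v *\<^sub>R q =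
        ((u *\<^sub>R y + v *\<^sub>R y') - (u *\<^sub>R k + v *\<^sub>R k'),
         \<beta> - \<alpha> \<bullet> (u *\<^sub>R x + v *\<^sub>R x') + (u * s + v * s'))"
    proof -
      have "\<beta> = u * \<beta> + v * \<beta>" using uv(3) by (metis distrib_right mult_1)
      then show ?thesis
        by (simp add: p q inner_add_right algebra_simps)
    qed
    ultimately show "u *\<^sub>R p + v *\<^sub>R q \<in> S" by (metis SI)
  qed
  moreover have "S \<noteq> {}" using SI[OF H'I[OF x0 y0K'] zeroK', of 1] by auto
  moreover have "0 \<notin> S"
  proof
    assume "0 \<in> S"
    then obtain x y s where "(x, y) \<in> H'" "y \<in> K'" "\<beta> - \<alpha> \<bullet> x + s = 0" "0 < s"
      unfolding S_def zero_prod_def by auto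
    then show False using valid[of x y] by (auto simp: H'_def K'_def)
  qed
  \<comment> \<open>The normal is taken inside the span of \<open>S\<close>, so \<open>t\<close>
    lies in the span of \<open>K'\<close>; this excludes a degenerate multiplier below.\<close>
  ultimately obtain a where a: "a \<in> span S" "a \<noteq> 0" "\<And>x. x \<in> S \<Longrightarrow> 0 \<le> a \<bullet> x"
    using separating_hyperplane_set_0_inspan by metis
  obtain t \<mu> where t\<mu>: "a = (t, \<mu>)" by (cases a)
  have sep: "0 \<le> t \<bullet> (y - k) + \<mu> * (\<beta> - \<alpha> \<bullet> x + s)" if "(x, y) \<in> H'" "k \<in> K'" "0 < s" for x y k s
    using a(3)[OF SI[OF that]] by (simp add: t\<mu>)
  have t_span: "t \<in> span K'"
  proof -
    have "S \<subseteq> {p. fst p \<in> span K'}"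
      by (auto simp: S_def H'_def intro!: span_diff intro: span_base)
    moreover have "subspace {p :: 'b \<times> real. fst p \<in> span K'}"
      by (auto simp: subspace_def intro: span_zero span_add span_scale)
    ultimately have "span S \<subseteq> {p. fst p \<in> span K'}" by (rule span_minimal)
    then show ?thesis using a(1) t\<mu> by auto
  qed
  \<comment> \<open>Scaling \<open>k\<close> without bound would violate separation if
    \<open>t\<close> were positive on it. The sign of \<open>\<mu>\<close> follows likewise from
    large \<open>s\<close>.\<close>
  have tK': "t \<bullet> k \<le> 0" if k: "k \<in> K'" for k
  proof (rule ccontr)
    assume pos: "\<not> t \<bullet> k \<le> 0"
    define C where "C = t \<bullet> y0 + \<mu> * (\<beta> - \<alpha> \<bullet> x0 + 1)"
    have "0 \<le> C - N * (t \<bullet> k)" if "0 \<le> N" for N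
      using sep[OF H'I[OF x0 y0K'] K'scale[OF k that], of 1] by (simp add: C_def inner_diff_right)
    from this[of "(\<bar>C\<bar> + 1) / (t \<bullet> k)"] show False using pos by simp
  qed
  have "0 \<le> \<mu>"
  proof (rule ccontr)
    assume neg: "\<not> 0 \<le> \<mu>"
    define C where "C = t \<bullet> y0 + \<mu> * (\<beta> - \<alpha> \<bullet> x0)"
    have "0 \<le> C + \<mu> * s" if "0 < s" for s
      using sep[OF H'I[OF x0 y0K'] zeroK' that] by (simp add: C_def algebra_simps)
    moreover have "0 < (\<bar>C\<bar> + 1) / (- \<mu>)" using neg by (intro divide_pos_pos) auto
    moreover have "\<mu> * ((\<bar>C\<bar> + 1) / (- \<mu>)) = - (\<bar>C\<bar> + 1)" using neg by simp
    ultimately have "0 \<le> C - (\<bar>C\<bar> + 1)" by (metis diff_conv_add_uminus)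
    then show False by linarith
  qed
  \<comment> \<open>Slater argument: if \<open>\<mu> = 0\<close>, then \<open>t\<close> vanishes at
    \<open>y0\<close>. Both \<open>k\<close> and \<open>N *\<^sub>R y0 - k\<close> lie in the face,
    so \<open>t\<close> vanishes on its span, which contains \<open>t\<close>.\<close>
  moreover have "\<mu> \<noteq> 0"
  proof
    assume "\<mu> = 0"
    then have ty0: "t \<bullet> y0 = 0"
      using sep[OF H'I[OF x0 y0K'] zeroK', of 1] tK'[OF y0K'] by simp
    have "t \<bullet> k = 0" if k: "k \<in> K'" for k
    proof -
      obtain N where N: "k \<in> K" "0 \<le> N" "N *\<^sub>R y0 - k \<in> K"
        using k unfolding K'_def by blast
      then have "N *\<^sub>R y0 - k \<in> K'" by (intro K'I[of _ N]) auto
      from tK'[OF this] tK'[OF k] show ?thesis by (simp add: inner_diff_right ty0)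
    qed
    then have "orthogonal t t"
      using t_span by (intro orthogonal_to_span[of t K']) (auto simp: orthogonal_def)
    then show False using a(2) \<open>\<mu> = 0\<close> t\<mu> by (simp add: orthogonal_def zero_prod_def)
  qed
  ultimately have \<mu>: "0 < \<mu>" by simp
  \<comment> \<open>After normalization \<open>\<beta> + f\<close> is the slack minus the multiplier
    term. It is nonnegative on the affine set \<open>H'\<close>, hence constant there; this constant
    is \<open>c\<close>.\<close>
  define T where "T = - (1 / \<mu>) *\<^sub>R t"
  define f where "f p = - (\<alpha> \<bullet> fst p) - T \<bullet> snd p" for p
  have "linear f"
    by (rule linearI) (simp_all add: f_def inner_add_right algebra_simps)
  have f_ge: "0 \<le> \<beta> + f p" if p: "p \<in> H'" for p
  proof (rule field_le_epsilon)
    fix s :: real assume "0 < s"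
    then have "0 \<le> t \<bullet> snd p + \<mu> * (\<beta> - \<alpha> \<bullet> fst p + s)"
      using sep[of "fst p" "snd p" 0 s] p zeroK' by simp
    also have "\<dots> = \<mu> * (\<beta> + f p + s)"
      using \<mu> by (simp add: f_def T_def field_simps)
    finally show "0 \<le> \<beta> + f p + s"
      using \<mu> by (simp add: zero_le_mult_iff)
  qed
  show thesis
  proof (rule that[of y0 "\<beta> + f (x0, y0)" T])
    show "y0 \<in> K" by fact
    show "0 \<le> \<beta> + f (x0, y0)" by (intro f_ge H'I x0 y0K')
    show "0 \<le> T \<bullet> k" if "k \<in> K" "0 \<le> N" "N *\<^sub>R y0 - k \<in> K" for k N
      using tK'[OF K'I[OF that]] \<mu> by (simp add: T_def divide_nonpos_pos)
    fix x y assume xy: "(x, y) \<in> H" "y \<in> K"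
    then have yK': "y \<in> K'" by (intro WK') (force simp: W_def)
    then show "\<exists>N\<ge>0. N *\<^sub>R y0 - y \<in> K" by (simp add: K'_def)
    have "f (x, y) = f (x0, y0)"
    proof (rule affine_bounded_below_const[OF aff \<open>linear f\<close>])
      show "- \<beta> \<le> f p" if "p \<in> H'" for p using f_ge[OF that] by simp
    qed (auto intro: H'I xy yK' x0 y0K')
    then show "\<beta> - \<alpha> \<bullet> x = T \<bullet> y + (\<beta> + f (x0, y0))"
      by (simp add: f_def)
  qed
qed

section \<open>Semidefinite extensions and PSD factorizations\<close>

lemma exI2: "R x y \<Longrightarrow> \<exists>x y. R x y"
  by blast

section \<open>Symmetric matrices as coordinate vectors\<close>

lemma smat_add: "smat (x + y) = smat x + smat y"
  by (simp add: smat_def vec_eq_iff add_divide_distrib)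

lemma smat_scaleR: "smat (c *\<^sub>R x) = c *\<^sub>R smat x"
  by (simp add: smat_def vec_eq_iff)

lemma smat_diff: "smat (x - y) = smat x - smat y"
  by (simp add: smat_def vec_eq_iff diff_divide_distrib)

lemma convex_psd_cone: "convex psd_cone"
  by (rule convexI) (simp add: psd_cone_def smat_add smat_scaleR psd_add psd_scaleR)

lemma cone_psd_cone: "cone psd_cone"
  by (simp add: cone_def psd_cone_def smat_scaleR psd_scaleR)

lemma obtain_smat:
  assumes "transpose X = X"
  obtains y where "smat y = X"
  using assms range_smat that by (metis (mono_tags, lifting) imageE mem_Collect_eq)

lemma trace_smat: "trace (smat x ** smat y) = x \<bullet> y"
  using inner_smat[of x y] by (simp add: transpose_smat)

text \<open>Conic duality guarantees nonnegativity of the multiplier on the minimal face only;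
  \<open>psd_extend_from_face\<close> replaces it by a PSD matrix with the same values on that face,
  where all feasible \<open>y\<close> lie.\<close>

lemma semidefinite_extension_duality:
  fixes Q :: "((real^'d) \<times> (real^('r::finite uprod))) set"
  assumes ext: "semidefinite_extension Q P" and "P \<noteq> {}"
    and valid: "\<And>x. x \<in> P \<Longrightarrow> \<alpha> \<bullet> x \<le> \<beta>"
  obtains T :: "real^'r^'r" and c where "psd T" "0 \<le> c"
    "\<And>x y. (x, y) \<in> Q \<Longrightarrow> \<beta> - \<alpha> \<bullet> x = trace (T ** smat y) + c"
proof -
  obtain p E F g where
      Q: "Q = {(x, y). (\<forall>k<(p::nat). E k \<bullet> x + F k \<bullet> y = g k) \<and> y \<in> psd_cone}"
    using ext unfolding semidefinite_extension_def by blast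
  have P: "P = {x. \<exists>y. (x, y) \<in> Q}"
    using ext unfolding semidefinite_extension_def by blast
  define H where "H = {(x, y). \<forall>k<p. E k \<bullet> x + F k \<bullet> y = g k}"
  have QH: "(x, y) \<in> Q \<longleftrightarrow> (x, y) \<in> H \<and> y \<in> psd_cone" for x y
    by (simp add: Q H_def)
  have "affine H"
    unfolding affine_def H_def
  proof clarsimp
    fix x y x' y' u v k
    assume h: "\<forall>k<p. E k \<bullet> x + F k \<bullet> y = g k" "\<forall>k<p. E k \<bullet> x' + F k \<bullet> y' = g k"
      and uv: "u + v = (1::real)" and k: "k < p"
    have "E k \<bullet> (u *\<^sub>R x + v *\<^sub>R x') + F k \<bullet> (u *\<^sub>R y + v *\<^sub>R y') =
        u * (E k \<bullet> x + F k \<bullet> y) + v * (E k \<bullet> x' + F k \<bullet> y')"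
      by (simp add: inner_add_right algebra_simps)
    also have "\<dots> = (u + v) * g k" using h k by (simp add: distrib_right)
    finally show "E k \<bullet> (u *\<^sub>R x + v *\<^sub>R x') + F k \<bullet> (u *\<^sub>R y + v *\<^sub>R y') = g k"
      by (simp add: uv)
  qed
  obtain x1 y1 where "(x1, y1) \<in> Q" using \<open>P \<noteq> {}\<close> P by blast
  then have x1: "(x1, y1) \<in> H" "y1 \<in> psd_cone" by (simp_all add: QH)
  have valid_H: "\<alpha> \<bullet> x \<le> \<beta>" if "(x, y) \<in> H" "y \<in> psd_cone" for x y
    using that P QH by (intro valid) blast
  obtain y0 c t where y0: "y0 \<in> psd_cone" and c: "0 \<le> c"
    and t: "\<And>k N. k \<in> psd_cone \<Longrightarrow> 0 \<le> N \<Longrightarrow> N *\<^sub>R y0 - k \<in> psd_cone \<Longrightarrow> 0 \<le> t \<bullet> k"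
    and face: "\<And>x y. (x, y) \<in> H \<Longrightarrow> y \<in> psd_cone \<Longrightarrow> \<exists>N\<ge>0. N *\<^sub>R y0 - y \<in> psd_cone"
    and eq: "\<And>x y. (x, y) \<in> H \<Longrightarrow> y \<in> psd_cone \<Longrightarrow> \<beta> - \<alpha> \<bullet> x = t \<bullet> y + c"
    by (rule cone_duality[OF \<open>affine H\<close> convex_psd_cone cone_psd_cone x1], erule (1) valid_H) (rule that; blast)
  have X: "psd (smat y0)" using y0 by (simp add: psd_cone_def)
  have nonneg: "0 \<le> trace (smat t ** Z)" if Z: "psd Z" "0 \<le> N" "psd (N *\<^sub>R smat y0 - Z)" for Z N
  proof -
    obtain k where k: "smat k = Z" using obtain_smat[OF psd_transpose[OF Z(1)]] .
    have "0 \<le> t \<bullet> k"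
      using Z by (intro t[of k N]) (simp_all add: psd_cone_def smat_diff smat_scaleR k)
    then show ?thesis by (simp add: k[symmetric] trace_smat)
  qed
  obtain T where T: "psd T"
    "\<And>Z N. psd Z \<Longrightarrow> 0 \<le> N \<Longrightarrow> psd (N *\<^sub>R smat y0 - Z) \<Longrightarrow> trace (T ** Z) = trace (smat t ** Z)"
    by (rule psd_extend_from_face[OF X transpose_smat], erule (2) nonneg) (rule that, assumption, simp)
  show thesis
  proof
    show "psd T" "0 \<le> c" by fact+
    fix x y assume "(x, y) \<in> Q"
    then have xy: "(x, y) \<in> H" "y \<in> psd_cone" by (simp_all add: QH)
    then obtain N where N: "0 \<le> N" "N *\<^sub>R y0 - y \<in> psd_cone" using face by blast
    have "trace (T ** smat y) = t \<bullet> y"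
      using T(2)[of "smat y" N] N xy by (simp add: psd_cone_def smat_diff smat_scaleR trace_smat)
    then show "\<beta> - \<alpha> \<bullet> x = trace (T ** smat y) + c" using eq[OF xy] by simp
  qed
qed

text \<open>
  This removes the constant left over by duality when an inequality is not tight:
  on a nontrivial polytope \<open>M - \<alpha> x\<close> and \<open>\<alpha> x - \<mu>\<close>, for the extreme values \<open>M\<close> and \<open>\<mu>\<close>,
  are represented without a constant, and they sum to \<open>M - \<mu> > 0\<close>.
\<close>
lemma semidefinite_extension_represents_one:
  fixes Q :: "((real^'d) \<times> (real^('r::finite uprod))) set"
  assumes ext: "semidefinite_extension Q P" and P: "compact P" and "a \<in> P" "b \<in> P" "a \<noteq> b"
  obtains C :: "real^'r^'r" where "psd C" "\<And>x y. (x, y) \<in> Q \<Longrightarrow> trace (C ** smat y) = 1"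
proof -
  have proj: "P = {x. \<exists>y. (x, y) \<in> Q}" and Qpsd: "\<And>x y. (x, y) \<in> Q \<Longrightarrow> psd (smat y)"
    using ext unfolding semidefinite_extension_def psd_cone_def by blast+
  have "P \<noteq> {}" using \<open>a \<in> P\<close> by blast
  have tight: "\<exists>T :: real^'r^'r. \<exists>z\<in>P. psd T \<and>
      (\<forall>x y. (x, y) \<in> Q \<longrightarrow> \<alpha> \<bullet> z - \<alpha> \<bullet> x = trace (T ** smat y)) \<and> (\<forall>x\<in>P. \<alpha> \<bullet> x \<le> \<alpha> \<bullet> z)" for \<alpha>
  proof -
    obtain z where z: "z \<in> P" "\<And>x. x \<in> P \<Longrightarrow> \<alpha> \<bullet> x \<le> \<alpha> \<bullet> z"
      using continuous_attains_sup[OF P \<open>P \<noteq> {}\<close> continuous_on_inner[OF continuous_on_const continuous_on_id]]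
      by blast
    obtain T c where T: "psd T" "0 \<le> c"
        "\<And>x y. (x, y) \<in> Q \<Longrightarrow> \<alpha> \<bullet> z - \<alpha> \<bullet> x = trace (T ** smat y) + c"
      using semidefinite_extension_duality[OF ext \<open>P \<noteq> {}\<close> z(2)] by metis
    obtain y where y: "(z, y) \<in> Q" using z(1) proj by blast
    \<comment> \<open>At the maximizer the slack is zero, and it is a sum of two nonnegative
      terms.\<close>
    have "c = 0"
      using T(3)[OF y] T(2) psd_trace_mult_nonneg[OF T(1) Qpsd[OF y]] by simp
    then show ?thesis using T(1,3) z by (intro exI[of _ T] bexI[of _ z]) auto
  qed
  obtain T1 z1 where 1: "z1 \<in> P" "psd T1" "\<forall>x\<in>P. (a - b) \<bullet> x \<le> (a - b) \<bullet> z1"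
      "\<And>x y. (x, y) \<in> Q \<Longrightarrow> (a - b) \<bullet> z1 - (a - b) \<bullet> x = trace (T1 ** smat y)"
    using tight[of "a - b"] by blast
  obtain T2 z2 where 2: "z2 \<in> P" "psd T2" "\<forall>x\<in>P. (b - a) \<bullet> x \<le> (b - a) \<bullet> z2"
      "\<And>x y. (x, y) \<in> Q \<Longrightarrow> (b - a) \<bullet> z2 - (b - a) \<bullet> x = trace (T2 ** smat y)"
    using tight[of "b - a"] by blast
  \<comment> \<open>The difference of the extreme values of \<open>a - b\<close> on
    \<open>P\<close>; comparing with the points \<open>a\<close> and \<open>b\<close> bounds it
    below by \<open>|a - b|^2\<close>.\<close>
  define \<delta> where "\<delta> = (a - b) \<bullet> z1 + (b - a) \<bullet> z2"
  have "0 < (a - b) \<bullet> (a - b)" using \<open>a \<noteq> b\<close> by simp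
  also have "\<dots> = (a - b) \<bullet> a + (b - a) \<bullet> b" by (simp add: inner_diff_left inner_diff_right)
  also have "\<dots> \<le> \<delta>" using 1(3) 2(3) \<open>a \<in> P\<close> \<open>b \<in> P\<close> unfolding \<delta>_def by (intro add_mono) auto
  finally have \<delta>: "0 < \<delta>" .
  show thesis
  proof
    show "psd ((1 / \<delta>) *\<^sub>R (T1 + T2))"
      using \<delta> 1 2 by (intro psd_scaleR psd_add) auto
    fix x y assume xy: "(x, y) \<in> Q"
    have "trace ((T1 + T2) ** smat y) = \<delta>"
      using 1(4)[OF xy] 2(4)[OF xy]
      by (simp add: matrix_add_rdistrib trace_add \<delta>_def inner_diff_left)
    then show "trace (((1 / \<delta>) *\<^sub>R (T1 + T2)) ** smat y) = 1"
      using \<delta> by (simp add: matrix_mult_scaleR_left trace_scaleR)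
  qed
qed

text \<open>Row factors represent the slack functions on \<open>Q\<close>, with the constant of
  duality absorbed by \<open>C\<close>; column factors are lifts of the \<open>v j\<close>. If
  \<open>P\<close> has at most one point, the rows of \<open>S\<close> are constant and rank one
  suffices.\<close>

lemma semidefinite_extension_imp_factorization:
  fixes P :: "(real^'d) set" and v :: "nat \<Rightarrow> real^'d"
  assumes P: "P = {x. \<forall>i<m. A i \<bullet> x \<le> b i}" "P = convex hull (v ` {..<n})"
    and S: "\<forall>i<m. \<forall>j<n. S i j = b i - A i \<bullet> v j"
    and "has_semidefinite_extension TYPE('r::finite) P"
  shows "has_psd_factorization TYPE('r) m n S"
proof -
  obtain Q :: "((real^'d) \<times> (real^('r uprod))) set" where ext: "semidefinite_extension Q P"
    using assms(4) unfolding has_semidefinite_extension_def by blast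
  have proj: "P = {x. \<exists>y. (x, y) \<in> Q}" and Qpsd: "\<And>x y. (x, y) \<in> Q \<Longrightarrow> psd (smat y)"
    using ext unfolding semidefinite_extension_def psd_cone_def by blast+
  have vP: "v j \<in> P" if "j < n" for j
    using that unfolding P(2) by (intro hull_inc) auto
  show ?thesis
  proof (cases "\<exists>a\<in>P. \<exists>a'\<in>P. a \<noteq> a'")
    case True
    have "compact P"
      unfolding P(2) by (intro compact_convex_hull finite_imp_compact) auto
    then obtain C :: "real^'r^'r" where C: "psd C" "\<And>x y. (x, y) \<in> Q \<Longrightarrow> trace (C ** smat y) = 1"
      using True semidefinite_extension_represents_one[OF ext] by metis
    have "P \<noteq> {}" using True by blast
    have "\<exists>T :: real^'r^'r. psd T \<and> (\<forall>x y. (x, y) \<in> Q \<longrightarrow> trace (T ** smat y) = b i - A i \<bullet> x)"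
      if i: "i < m" for i
    proof -
      have "A i \<bullet> x \<le> b i" if "x \<in> P" for x using that i by (simp add: P(1))
      then obtain T c where T: "psd T" "0 \<le> c"
          "\<And>x y. (x, y) \<in> Q \<Longrightarrow> b i - A i \<bullet> x = trace (T ** smat y) + c"
        using semidefinite_extension_duality[OF ext \<open>P \<noteq> {}\<close>] by metis
      have "psd (T + c *\<^sub>R C)" using T C by (intro psd_add psd_scaleR)
      moreover have "trace ((T + c *\<^sub>R C) ** smat y) = b i - A i \<bullet> x" if "(x, y) \<in> Q" for x y
        using T(3)[OF that] C(2)[OF that]
        by (simp add: matrix_add_rdistrib trace_add matrix_mult_scaleR_left trace_scaleR)
      ultimately show ?thesis by blast
    qed
    then obtain T :: "nat \<Rightarrow> real^'r^'r" where T: "\<And>i. i < m \<Longrightarrow> psd (T i)"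
        "\<And>i x y. i < m \<Longrightarrow> (x, y) \<in> Q \<Longrightarrow> trace (T i ** smat y) = b i - A i \<bullet> x"
      by metis
    have "\<exists>y. (v j, y) \<in> Q" if "j < n" for j using vP[OF that] proj by blast
    then obtain y where y: "\<And>j. j < n \<Longrightarrow> (v j, y j) \<in> Q" by metis
    show ?thesis
      unfolding has_psd_factorization_def
      using T S y Qpsd[OF y] by (intro exI2[of _ T "\<lambda>j. smat (y j)"]) auto
  next
    case False
    define e :: "real^'r" where "e = axis undefined 1"
    have tr: "trace (outer e ** outer e) = 1"
      by (simp add: trace_mult_outer outer_mult e_def inner_axis_axis)
    \<comment> \<open>For \<open>n = 0\<close> the entry \<open>S i 0\<close> is unconstrained; the
      truncation by \<open>max 0\<close> below keeps the factor PSD in that case too.\<close>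
    define s where "s i = S i 0" for i
    have s: "S i j = s i" if "i < m" "j < n" for i j
    proof -
      have "v j = v 0" using False vP[of j] vP[of 0] that by auto
      then show ?thesis using S that by (simp add: s_def)
    qed
    have "0 \<le> S i j" if "i < m" "j < n" for i j
      using vP[OF that(2)] that S by (simp add: P(1))
    then have s_nonneg: "0 \<le> max 0 (s i)" for i by simp
    have "trace ((max 0 (s i) *\<^sub>R outer e) ** outer e) = S i j" if "i < m" "j < n" for i j
      using s[OF that] \<open>\<And>i j. i < m \<Longrightarrow> j < n \<Longrightarrow> 0 \<le> S i j\<close>[OF that]
      by (simp add: matrix_mult_scaleR_left trace_scaleR tr)
    then show ?thesis
      unfolding has_psd_factorization_def
      by (intro exI2[of _ "\<lambda>i. max 0 (s i) *\<^sub>R outer e" "\<lambda>j. outer e"])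
        (auto intro!: psd_scaleR psd_outer)
  qed
qed

text \<open>On \<open>Q\<close> the slack of \<open>x\<close> equals a trace of two PSD matrices, so
  \<open>Q\<close> projects into \<open>P\<close>. Conversely the projection is convex and contains
  each \<open>v j\<close>, lifted by \<open>U j\<close>.\<close>

lemma factorization_imp_semidefinite_extension:
  fixes P :: "(real^'d) set" and v :: "nat \<Rightarrow> real^'d"
  assumes P: "P = {x. \<forall>i<m. A i \<bullet> x \<le> b i}" "P = convex hull (v ` {..<n})"
    and S: "\<forall>i<m. \<forall>j<n. S i j = b i - A i \<bullet> v j"
    and "has_psd_factorization TYPE('r::finite) m n S"
  shows "has_semidefinite_extension TYPE('r) P"
proof -
  obtain T U :: "nat \<Rightarrow> real^'r^'r" where T: "\<And>i. i < m \<Longrightarrow> psd (T i)"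
      and U: "\<And>j. j < n \<Longrightarrow> psd (U j)" and TU: "\<And>i j. i < m \<Longrightarrow> j < n \<Longrightarrow> trace (T i ** U j) = S i j"
    using assms(4) unfolding has_psd_factorization_def by blast
  have "\<exists>t. smat t = T i" if "i < m" for i
    using obtain_smat[OF psd_transpose[OF T[OF that]]] by blast
  then obtain t where t: "\<And>i. i < m \<Longrightarrow> smat (t i) = T i" by metis
  have "\<exists>u. smat u = U j" if "j < n" for j
    using obtain_smat[OF psd_transpose[OF U[OF that]]] by blast
  then obtain u where u: "\<And>j. j < n \<Longrightarrow> smat (u j) = U j" by metis
  define Q where "Q = {(x, y :: real^('r uprod)). (\<forall>i<m. A i \<bullet> x + t i \<bullet> y = b i) \<and> y \<in> psd_cone}"
  have "P = {x. \<exists>y. (x, y) \<in> Q}"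
  proof (intro equalityI subsetI CollectI)
    have "convex {x. \<exists>y. (x, y) \<in> Q}"
    proof (rule convexI)
      fix x x' and c c' :: real
      assume "x \<in> {x. \<exists>y. (x, y) \<in> Q}" "x' \<in> {x. \<exists>y. (x, y) \<in> Q}"
        and c: "0 \<le> c" "0 \<le> c'" "c + c' = 1"
      then obtain y y' where y: "(x, y) \<in> Q" "(x', y') \<in> Q" by blast
      have "A i \<bullet> (c *\<^sub>R x + c' *\<^sub>R x') + t i \<bullet> (c *\<^sub>R y + c' *\<^sub>R y') = b i" if "i < m" for i
      proof -
        have "A i \<bullet> (c *\<^sub>R x + c' *\<^sub>R x') + t i \<bullet> (c *\<^sub>R y + c' *\<^sub>R y') =
            c * (A i \<bullet> x + t i \<bullet> y) + c' * (A i \<bullet> x' + t i \<bullet> y')"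
          by (simp add: inner_add_right algebra_simps)
        also have "\<dots> = (c + c') * b i" using y that by (simp add: Q_def distrib_right)
        finally show ?thesis by (simp add: c)
      qed
      moreover have "c *\<^sub>R y + c' *\<^sub>R y' \<in> psd_cone"
        using y c by (intro convexD[OF convex_psd_cone]) (auto simp: Q_def)
      ultimately show "c *\<^sub>R x + c' *\<^sub>R x' \<in> {x. \<exists>y. (x, y) \<in> Q}" by (auto simp: Q_def)
    qed
    moreover have "v j \<in> {x. \<exists>y. (x, y) \<in> Q}" if j: "j < n" for j
    proof -
      have "A i \<bullet> v j + t i \<bullet> u j = b i" if i: "i < m" for i
        using TU[OF i j] S i j by (simp add: trace_smat t[OF i, symmetric] u[OF j, symmetric])
      then have "(v j, u j) \<in> Q" using U[OF j] u[OF j] by (simp add: Q_def psd_cone_def)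
      then show ?thesis by blast
    qed
    ultimately have "P \<subseteq> {x. \<exists>y. (x, y) \<in> Q}"
      unfolding P(2) by (intro hull_minimal) auto
    then show "\<exists>y. (x, y) \<in> Q" if "x \<in> P" for x using that by blast
  next
    fix x assume "x \<in> {x. \<exists>y. (x, y) \<in> Q}"
    then obtain y where y: "(x, y) \<in> Q" by blast
    have "A i \<bullet> x \<le> b i" if i: "i < m" for i
    proof -
      have "0 \<le> trace (T i ** smat y)"
        using y by (intro psd_trace_mult_nonneg T i) (simp add: Q_def psd_cone_def)
      then have "0 \<le> t i \<bullet> y" by (simp add: t[OF i, symmetric] trace_smat)
      moreover have "A i \<bullet> x + t i \<bullet> y = b i" using y i by (simp add: Q_def)
      ultimately show ?thesis by linarith
    qed
    then show "x \<in> P" by (simp add: P(1))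
  qed
  then have "semidefinite_extension Q P"
    unfolding semidefinite_extension_def Q_def by blast
  then show ?thesis unfolding has_semidefinite_extension_def by blast
qed

section \<open>One-way quantum protocols\<close>

text \<open>Alice's states serve as row factors; \<open>U j\<close> is the observable whose
  expectation is that of Bob's output, PSD because his labels are nonnegative.\<close>

lemma protocol_imp_factorization:
  assumes "has_quantum_protocol TYPE('r::finite) m n S"
  shows "has_psd_factorization TYPE('r) m n S"
proof -
  obtain \<rho> :: "nat \<Rightarrow> real^'r^'r" and \<Theta> E
    where prot: "one_way_protocol m n \<rho> \<Theta> E" and comp: "computes_in_expectation m n S \<rho> \<Theta> E"
    using assms unfolding has_quantum_protocol_def by blast
  define U where "U j = (\<Sum>\<theta>\<in>\<Theta> j. \<theta> *\<^sub>R E j \<theta>)" for j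
  have "psd (U j)" if "j < n" for j
    using prot that unfolding U_def one_way_protocol_def povm_def
    by (intro psd_sum psd_scaleR) auto
  moreover have "trace (X ** U j) = (\<Sum>\<theta>\<in>\<Theta> j. \<theta> * trace (E j \<theta> ** X))" for X :: "real^'r^'r" and j
  proof -
    have "trace (X ** (\<Sum>\<theta>\<in>I. \<theta> *\<^sub>R E j \<theta>)) = (\<Sum>\<theta>\<in>I. \<theta> * trace (E j \<theta> ** X))" for I
    proof (induction I rule: infinite_finite_induct)
      case (insert \<theta> I)
      then show ?case
        by (simp add: matrix_add_ldistrib trace_add matrix_mult_scaleR_right trace_scaleR
            trace_mul_sym[of X "E j \<theta>"])
    qed (simp_all add: trace_def matrix_matrix_mult_def)
    then show ?thesis by (simp add: U_def)
  qed
  ultimately show ?thesis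
    using prot comp
    unfolding has_psd_factorization_def one_way_protocol_def quantum_state_def
      computes_in_expectation_def
    by (intro exI2[of _ \<rho> U]) auto
qed

text \<open>
  The spare dimension \<open>e\<close> carries the weight that \<open>T i\<close>, rescaled by a common factor, lacks to
  trace one; Bob's measurement gives zero there. Two outcomes suffice for Bob, who reports
  either zero or an upper bound on the spectrum of his matrix.
\<close>
lemma factorization_imp_protocol:
  assumes card: "CARD('r::finite) < CARD('s::finite)"
    and "has_psd_factorization TYPE('r) m n S"
  shows "has_quantum_protocol TYPE('s) m n S"
proof -
  obtain T U :: "nat \<Rightarrow> real^'r^'r" where T: "\<And>i. i < m \<Longrightarrow> psd (T i)"
      and U: "\<And>j. j < n \<Longrightarrow> psd (U j)" and TU: "\<And>i j. i < m \<Longrightarrow> j < n \<Longrightarrow> trace (T i ** U j) = S i j"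
    using assms(2) unfolding has_psd_factorization_def by blast
  obtain f :: "'r \<Rightarrow> 's" where f: "inj f"
    using card_le_inj[of "UNIV :: 'r set" "UNIV :: 's set"] card by auto
  have "card (range f) < CARD('s)" using card card_image[OF f] by simp
  then obtain k0 where k0: "k0 \<notin> range f" by (metis UNIV_eq_I less_irrefl)
  define e :: "real^'s" where "e = axis k0 1"
  \<comment> \<open>An isometric embedding of coordinates whose range is orthogonal to the spare
    direction \<open>e\<close>.\<close>
  define J :: "real^'r^'s" where "J = (\<chi> a i. if a = f i then 1 else 0)"
  have JJ: "transpose J ** J = mat 1"
    using f by (auto simp: J_def matrix_matrix_mult_def transpose_def mat_def vec_eq_iff inj_eq
        if_distrib[of "\<lambda>x. x * _"] cong: if_cong)
  have Je: "transpose J *v e = 0"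
    using k0 by (auto simp: J_def e_def matrix_vector_mult_basis column_def transpose_def
        vec_eq_iff simp del: transpose_matrix_vector)
  define emb where "emb X = J ** X ** transpose J" for X
  have psd_emb: "psd (emb X)" if "psd X" for X
    using psd_congruence[OF that, of "transpose J"] by (simp add: emb_def)
  have trace_emb: "trace (emb X) = trace X" for X
    unfolding emb_def by (subst trace_mul_sym) (simp add: matrix_mul_assoc JJ)
  have emb_mult: "emb X ** emb Y = emb (X ** Y)" for X Y
  proof -
    have "emb X ** emb Y = J ** X ** (transpose J ** J) ** Y ** transpose J"
      by (simp add: emb_def matrix_mul_assoc)
    then show ?thesis by (simp add: JJ emb_def matrix_mul_assoc)
  qed
  have emb_e: "trace (emb X ** outer e) = 0" for X
    by (simp add: trace_mult_outer emb_def matrix_vector_mul_assoc[symmetric] Je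
        del: transpose_matrix_vector)
  \<comment> \<open>A common bound on the traces; the summand \<open>1\<close> keeps it positive
    even if all of them vanish.\<close>
  define \<tau> where "\<tau> = 1 + (\<Sum>i<m. trace (T i))"
  have T_le: "trace (T i) \<le> \<tau>" if "i < m" for i
  proof -
    have "trace (T i) \<le> (\<Sum>i<m. trace (T i))"
      using that T by (intro member_le_sum) (auto intro: psd_trace_nonneg)
    then show ?thesis by (simp add: \<tau>_def)
  qed
  have "0 < \<tau>"
    using T unfolding \<tau>_def by (intro add_pos_nonneg sum_nonneg) (auto intro: psd_trace_nonneg)
  define \<rho> where "\<rho> i = (1 / \<tau>) *\<^sub>R emb (T i) + (1 - trace (T i) / \<tau>) *\<^sub>R outer e" for i
  \<comment> \<open>The factor \<open>\<tau>\<close> undoes the division by \<open>\<tau>\<close> in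
    the states.\<close>
  define M where "M j = \<tau> *\<^sub>R emb (U j)" for j
  \<comment> \<open>Above the trace, hence above the spectrum, of \<open>M j\<close>; being
    positive, it is a label distinct from zero.\<close>
  define L where "L j = 1 + trace (M j)" for j
  define E where "E j \<theta> = (if \<theta> = 0 then mat 1 - (1 / L j) *\<^sub>R M j else (1 / L j) *\<^sub>R M j)"
    for j and \<theta> :: real
  have M: "psd (M j)" if "j < n" for j
    unfolding M_def using \<open>0 < \<tau>\<close> U[OF that] by (intro psd_scaleR psd_emb) auto
  have L: "0 < L j" if "j < n" for j
    using psd_trace_nonneg[OF M[OF that]] by (simp add: L_def)
  have state: "quantum_state (\<rho> i)" if "i < m" for i
    unfolding quantum_state_def
  proof
    show "psd (\<rho> i)"
      unfolding \<rho>_def using \<open>0 < \<tau>\<close> T[OF that] T_le[OF that]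
      by (intro psd_add psd_scaleR psd_emb psd_outer) auto
    have "trace (outer e) = 1" by (simp add: trace_outer e_def inner_axis_axis)
    then show "trace (\<rho> i) = 1"
      using \<open>0 < \<tau>\<close> by (simp add: \<rho>_def trace_add trace_scaleR trace_emb)
  qed
  have povm: "povm {0, L j} (E j)" if j: "j < n" for j
    unfolding povm_def
  proof (intro conjI ballI)
    show "(\<Sum>\<theta>\<in>{0, L j}. E j \<theta>) = mat 1" using L[OF j] by (simp add: E_def)
    have "psd ((1 / L j) *\<^sub>R (mat 1 + (trace (M j) *\<^sub>R mat 1 - M j)))"
      using L[OF j] by (intro psd_scaleR psd_add psd_mat1 psd_le_trace M[OF j]) auto
    also have "(1 / L j) *\<^sub>R (mat 1 + (trace (M j) *\<^sub>R mat 1 - M j)) =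
        (1 / L j) *\<^sub>R (L j *\<^sub>R mat 1 - M j)"
      by (simp add: L_def scaleR_add_left algebra_simps)
    also have "\<dots> = mat 1 - (1 / L j) *\<^sub>R M j"
      using L[OF j] by (simp add: scaleR_diff_right)
    finally have "psd (mat 1 - (1 / L j) *\<^sub>R M j)" .
    then show "psd (E j \<theta>)" for \<theta>
      using L[OF j] M[OF j] by (auto simp: E_def intro!: psd_scaleR)
  qed simp
  have "(\<Sum>\<theta>\<in>{0, L j}. \<theta> * trace (E j \<theta> ** \<rho> i)) = S i j" if i: "i < m" and j: "j < n" for i j
  proof -
    have "(\<Sum>\<theta>\<in>{0, L j}. \<theta> * trace (E j \<theta> ** \<rho> i)) = trace (M j ** \<rho> i)"
      using L[OF j] by (simp add: E_def matrix_mult_scaleR_left trace_scaleR)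
    also have "\<dots> = trace (U j ** T i)"
      using \<open>0 < \<tau>\<close>
      by (simp add: M_def \<rho>_def matrix_mult_scaleR_left matrix_mult_scaleR_right
          matrix_add_ldistrib trace_add trace_scaleR emb_e emb_mult trace_emb)
    also have "\<dots> = S i j" using TU[OF i j] by (simp add: trace_mul_sym[of "U j"])
    finally show ?thesis .
  qed
  moreover have "0 \<le> \<theta>" if "j < n" "\<theta> \<in> {0, L j}" for j \<theta>
    using that L[of j] by auto
  ultimately show ?thesis
    unfolding has_quantum_protocol_def one_way_protocol_def computes_in_expectation_def
    using state povm by (intro exI[of _ \<rho>] exI[of _ "\<lambda>j. {0, L j}"] exI[of _ E]) blast
qed

text \<open>Ensures that a register with this many qubits has room for \<open>k\<close>
  dimensions.\<close>

lemma le_two_power_ceiling_log: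
  assumes "0 < k"
  shows "k \<le> 2 ^ nat \<lceil>log 2 (real k)\<rceil>"
proof -
  have "0 \<le> log 2 (real k)" using assms by simp
  then have "log 2 (real k) \<le> real (nat \<lceil>log 2 (real k)\<rceil>)"
    by linarith
  then have "real k \<le> 2 powr real (nat \<lceil>log 2 (real k)\<rceil>)"
    using assms by (subst (asm) log_le_iff) auto
  also have "\<dots> = real (2 ^ nat \<lceil>log 2 (real k)\<rceil>)" by (simp add: powr_realpow)
  finally show ?thesis by (simp only: of_nat_le_iff)
qed

text \<open>Matrix sizes are cardinalities of types, which are nonempty, so \<open>r\<close> is
  positive. The types \<open>'s\<close> and \<open>'q\<close> give the two readings of (iii), by
  exact dimension and by qubits; \<open>factorization_imp_protocol\<close> covers both, as each
  dimension exceeds \<open>r\<close>.\<close>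

theorem corollary15:
  fixes P :: "(real^'d) set" and m n r :: nat
    and A :: "nat \<Rightarrow> real^'d" and b :: "nat \<Rightarrow> real" and v :: "nat \<Rightarrow> real^'d"
    and S :: "nat \<Rightarrow> nat \<Rightarrow> real"
  assumes inequalities: "P = {x. \<forall>i<m. A i \<bullet> x \<le> b i}"
    and vertices: "P = convex hull (v ` {..<n})"
    and slack: "\<forall>i<m. \<forall>j<n. S i j = b i - A i \<bullet> v j"
    and card_r: "CARD('r::finite) = r"
    and card_s: "CARD('s::finite) = r + 1"
    and card_q: "CARD('q::finite) = 2 ^ nat \<lceil>log 2 (real (r + 1))\<rceil>"
  shows
    "(has_semidefinite_extension TYPE('r) P \<longleftrightarrow> has_psd_factorization TYPE('r) m n S) \<and>
     (has_semidefinite_extension TYPE('r) P \<longrightarrow>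
        has_quantum_protocol TYPE('s) m n S \<and> has_quantum_protocol TYPE('q) m n S) \<and>
     (has_psd_factorization TYPE('r) m n S \<longrightarrow>
        has_quantum_protocol TYPE('s) m n S \<and> has_quantum_protocol TYPE('q) m n S) \<and>
     (has_quantum_protocol TYPE('r) m n S \<longrightarrow> has_semidefinite_extension TYPE('r) P) \<and>
     (has_quantum_protocol TYPE('r) m n S \<longrightarrow> has_psd_factorization TYPE('r) m n S)"
proof -
  have q: "CARD('r) < CARD('q)"
    using le_two_power_ceiling_log[of "r + 1"] unfolding card_r card_q by linarith
  have "has_semidefinite_extension TYPE('r) P \<longleftrightarrow> has_psd_factorization TYPE('r) m n S"
    using semidefinite_extension_imp_factorization[OF inequalities vertices slack]
      factorization_imp_semidefinite_extension[OF inequalities vertices slack] by blast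
  moreover have "has_quantum_protocol TYPE('s) m n S \<and> has_quantum_protocol TYPE('q) m n S"
    if "has_psd_factorization TYPE('r) m n S"
    using q by (intro conjI factorization_imp_protocol[OF _ that]) (simp_all add: card_r card_s)
  moreover have "has_psd_factorization TYPE('r) m n S" if "has_quantum_protocol TYPE('r) m n S"
    using that by (rule protocol_imp_factorization)
  ultimately show ?thesis by blast
qed

end
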